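(* Let $a\in L^1(I)$ and suppose that the Neumann problem on $J$ with potential $\tilde a$ is nonresonant and $G_N[\tilde a,2T]<0$ on $J\times J$. Let $\sigma_1,\sigma_2\in L^1(I)$, let $u_N$ be the unique solution of the Neumann problem $u''+a(t)u=\sigma_1(t)$ a.e. on $I$, $u'(0)=u'(T)=0$, and let $u_{M_1}$ be the unique solution of the mixed problem $u''+a(t)u=\sigma_2(t)$ a.e. on $I$, $u'(0)=u(T)=0$. 1. If $0\le\sigma_2(t)\le\sigma_1(t)$ for a.e. $t\in I$, then $u_N(t)\le u_{M_1}(t)\le 0$ for all $t\in I$. 2. If $0\ge\sigma_2(t)\ge\sigma_1(t)$ for a.e. $t\in I$, then $u_N(t)\ge u_{M_1}(t)\ge 0$ for all $t\in I$.
   Context: Fix $T>0$ and put $I=[0,T]$, $J=[0,2T]$. Solutions are functions $u\in C^1$ with $u'$ absolutely continuous on the interval in question. $\tilde a$ is the even extension of $a$ to $J$: $\tilde a(t)=a(t)$ on $[0,T]$, $\tilde a(t)=a(2T-t)$ on $(T,2T]$. The Neumann problem on $J$ is $u''+\tilde a(t)u=\tilde\sigma(t)$ a.e. on $J$, $u'(0)=u'(2T)=0$; it is nonresonant if for $\tilde\sigma=0$ it has only the trivial solution, and then $G_N[\tilde a,2T]$ is its Green's function: the continuous function on $J\times J$ such that for each $\tilde\sigma\in L^1(J)$ the unique solution is $u(t)=\int_0^{2T}G_N[\tilde a,2T](t,s)\tilde\sigma(s)\,ds$. (If this problem is nonresonant, the two problems on $I$ with potential $a$ considered in the claim are uniquely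 solvable too.) *)

theory Defs
  imports "HOL-Analysis.Analysis"
begin

text \<open>Absolute continuity of a real function on an interval, in the usual
  \<open>\<epsilon>\<close>-\<open>\<delta>\<close> form. (The library constant
  \<open>absolutely_continuous\<close> is about measures.)\<close>

definition abs_continuous_on :: "real set \<Rightarrow> (real \<Rightarrow> real) \<Rightarrow> bool" where
  "abs_continuous_on S f \<longleftrightarrow>
     (\<forall>\<epsilon>>0. \<exists>\<delta>>0. \<forall>(n::nat) x y.
        (\<forall>i<n. x i \<in> S \<and> y i \<in> S \<and> x i \<le> y i) \<and>
        (\<forall>i<n. \<forall>j<n. i \<noteq> j \<longrightarrow> {x i<..<y i} \<inter> {x j<..<y j} = {}) \<and>
        (\<Sum>i<n. y i - x i) < \<delta>
        \<longrightarrow> (\<Sum>i<n. \<bar>f (y i) - f (x i)\<bar>) < \<epsilon>)"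

text \<open>\<open>u\<close> is a solution of \<open>u'' + a u = \<sigma>\<close> a.e. on \<open>[0,L]\<close> with derivative \<open>v\<close>:
  \<open>u\<close> is \<open>C\<^sup>1\<close> (continuity of \<open>v\<close> follows from its absolute continuity) and \<open>v = u'\<close> is
  absolutely continuous. Derivatives are taken within \<open>[0,L]\<close>, so they are one-sided
  at the end points and values of \<open>u\<close>, \<open>v\<close> outside \<open>[0,L]\<close> are irrelevant.\<close>

definition hill_solution ::
  "real \<Rightarrow> (real \<Rightarrow> real) \<Rightarrow> (real \<Rightarrow> real) \<Rightarrow> (real \<Rightarrow> real) \<Rightarrow> (real \<Rightarrow> real) \<Rightarrow> bool" where
  "hill_solution L a \<sigma> u v \<longleftrightarrow>
     (\<forall>t\<in>{0..L}. (u has_real_derivative v t) (at t within {0..L})) \<and>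
     abs_continuous_on {0..L} v \<and>
     (AE t in lebesgue_on {0..L}.
        \<exists>w. (v has_real_derivative w) (at t within {0..L}) \<and> w + a t * u t = \<sigma> t)"

definition neumann_solution ::
  "real \<Rightarrow> (real \<Rightarrow> real) \<Rightarrow> (real \<Rightarrow> real) \<Rightarrow> (real \<Rightarrow> real) \<Rightarrow> bool" where
  "neumann_solution L a \<sigma> u \<longleftrightarrow>
     (\<exists>v. hill_solution L a \<sigma> u v \<and> v 0 = 0 \<and> v L = 0)"

definition mixed1_solution ::
  "real \<Rightarrow> (real \<Rightarrow> real) \<Rightarrow> (real \<Rightarrow> real) \<Rightarrow> (real \<Rightarrow> real) \<Rightarrow> bool" where
  "mixed1_solution L a \<sigma> u \<longleftrightarrow>
     (\<exists>v. hill_solution L a \<sigma> u v \<and> v 0 = 0 \<and> u L = 0)"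

definition neumann_nonresonant :: "real \<Rightarrow> (real \<Rightarrow> real) \<Rightarrow> bool" where
  "neumann_nonresonant L a \<longleftrightarrow>
     (\<forall>u. neumann_solution L a (\<lambda>_. 0) u \<longrightarrow> (\<forall>t\<in>{0..L}. u t = 0))"

text \<open>\<open>G\<close> is the Green's function of the Neumann problem on \<open>[0,L]\<close>. The equivalence says that
  \<open>t \<mapsto> \<integral> G(t,s) \<sigma>(s) ds\<close> is the unique solution, functions being compared on \<open>[0,L]\<close>.\<close>

definition neumann_green :: "real \<Rightarrow> (real \<Rightarrow> real) \<Rightarrow> (real \<Rightarrow> real \<Rightarrow> real) \<Rightarrow> bool" where
  "neumann_green L a G \<longleftrightarrow>
     continuous_on ({0..L} \<times> {0..L}) (\<lambda>(t, s). G t s) \<and>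
     (\<forall>\<sigma>. \<sigma> absolutely_integrable_on {0..L} \<longrightarrow>
        (\<forall>u. neumann_solution L a \<sigma> u \<longleftrightarrow>
             (\<forall>t\<in>{0..L}. u t = (LINT s:{0..L}|lebesgue. G t s * \<sigma> s))))"

definition even_ext :: "real \<Rightarrow> (real \<Rightarrow> real) \<Rightarrow> real \<Rightarrow> real" where
  "even_ext T a t = (if t \<le> T then a t else a (2 * T - t))"

end

theory Submission
  imports Defs
begin

text \<open>The sign of the Green's function \<open>G\<close> enters only through one function,
  \<open>\<phi> t = - \<integral> G t s ds\<close>. It is positive on \<open>[0,2T]\<close> and solves \<open>\<phi>'' + b \<phi> = -1\<close> with
  Neumann conditions, where \<open>b\<close> is the even extension of \<open>a\<close>. Since \<open>b\<close> and the right-hand side are symmetric about \<open>T\<close>, the reflection of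
  \<open>\<phi>\<close> solves the same problem, so \<open>\<phi>\<close> is symmetric and \<open>\<phi>' T = 0\<close>
  (\<open>negative_green_imp_positive_torsion\<close>). On \<open>[0,T]\<close> it is therefore a positive strict
  supersolution with vanishing derivative at both ends.

  Such a function yields a maximum principle (\<open>maximum_principle\<close>): if \<open>u'' + a u \<ge> 0\<close>,
  \<open>u' 0 = 0\<close>, and \<open>u T \<le> 0\<close> or \<open>u' T = 0\<close>, then \<open>u \<le> 0\<close>. For suppose that \<open>u / \<phi>\<close> has a positive
  maximum at \<open>c\<close>. The Wronskian \<open>W = u' \<phi> - u \<phi>'\<close> vanishes at \<open>c\<close>, while
  \<open>W' = (u'' + a u) \<phi> + u \<ge> u > 0\<close> a.e. near \<open>c\<close>; hence \<open>(u / \<phi>)' = W / \<phi>\<^sup>2\<close> is positive to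
  the right of \<open>c\<close> and negative to the left, so that \<open>c\<close> is a strict local minimum instead.

  The comparison is three applications of this principle (\<open>neumann_mixed_comparison\<close>). It gives
  \<open>u\<^sub>M \<le> 0\<close> and \<open>u\<^sub>N \<le> 0\<close>; as \<open>u\<^sub>M T = 0\<close>, the second inequality at \<open>T\<close> says
  that \<open>u\<^sub>N - u\<^sub>M\<close>, whose right-hand side is \<open>\<sigma>1 - \<sigma>2 \<ge> 0\<close>, is nonpositive at \<open>T\<close>, and the
  principle applies to this difference.
  The second part of the theorem is the first one for \<open>- u\<^sub>N\<close> and \<open>- u\<^sub>M\<close>.

  The analytic input is that \<open>W\<close>, whose derivative exists only almost everywhere, is monotone where
  that derivative is nonnegative. This holds because \<open>W\<close> is absolutely continuous
  (\<open>abs_continuous_on_increment_ge\<close>).\<close>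

section \<open>Absolutely continuous functions\<close>

definition thin_family :: "real set \<Rightarrow> real \<Rightarrow> nat \<Rightarrow> (nat \<Rightarrow> real) \<Rightarrow> (nat \<Rightarrow> real) \<Rightarrow> bool" where
  "thin_family S \<delta> n x y \<longleftrightarrow>
     (\<forall>i<n. x i \<in> S \<and> y i \<in> S \<and> x i \<le> y i) \<and>
     (\<forall>i<n. \<forall>j<n. i \<noteq> j \<longrightarrow> {x i<..<y i} \<inter> {x j<..<y j} = {}) \<and>
     (\<Sum>i<n. y i - x i) < \<delta>"

lemma abs_continuous_on_iff_thin_family:
  "abs_continuous_on S f \<longleftrightarrow> (\<forall>\<epsilon>>0. \<exists>\<delta>>0. \<forall>n x y.
     thin_family S \<delta> n x y \<longrightarrow> (\<Sum>i<n. \<bar>f (y i) - f (x i)\<bar>) < \<epsilon>)"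
  unfolding abs_continuous_on_def thin_family_def ..

lemma thin_family_mono:
  assumes "thin_family R \<delta> n x y" "R \<subseteq> S" "\<delta> \<le> \<eta>"
  shows "thin_family S \<eta> n x y"
  using assms unfolding thin_family_def by (meson subsetD order_less_le_trans)

lemma abs_continuous_onE:
  assumes "abs_continuous_on S f" "\<epsilon> > 0"
  obtains \<delta> where "\<delta> > 0"
    and "\<And>n x y. thin_family S \<delta> n x y \<Longrightarrow> (\<Sum>i<n. \<bar>f (y i) - f (x i)\<bar>) < \<epsilon>"
  using assms unfolding abs_continuous_on_iff_thin_family by meson

lemma abs_continuous_on_subset:
  assumes "abs_continuous_on S f" "R \<subseteq> S"
  shows "abs_continuous_on R f"
  using assms unfolding abs_continuous_on_iff_thin_family
  by (meson thin_family_mono order_refl)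

text \<open>Covers differences, products of bounded functions and, with \<open>f\<close> and \<open>g\<close> the identity,
  Lipschitz functions.\<close>

lemma abs_continuous_on_dominated:
  assumes f: "abs_continuous_on S f" and g: "abs_continuous_on S g"
    and h: "\<And>x y. x \<in> S \<Longrightarrow> y \<in> S \<Longrightarrow> \<bar>h y - h x\<bar> \<le> M * (\<bar>f y - f x\<bar> + \<bar>g y - g x\<bar>)"
  shows "abs_continuous_on S h"
  unfolding abs_continuous_on_iff_thin_family
proof (intro allI impI)
  fix \<epsilon> :: real assume "\<epsilon> > 0"
  \<comment> \<open>The summand 1 keeps the denominator positive when \<open>M = 0\<close>.\<close>
  define e where "e = \<epsilon> / (2 * (\<bar>M\<bar> + 1))"
  have "e > 0" using \<open>\<epsilon> > 0\<close> by (simp add: e_def)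
  from f this obtain d1 where "d1 > 0"
    and d1: "\<And>n x y. thin_family S d1 n x y \<Longrightarrow> (\<Sum>i<n. \<bar>f (y i) - f (x i)\<bar>) < e"
    by (rule abs_continuous_onE) blast
  from g \<open>e > 0\<close> obtain d2 where "d2 > 0"
    and d2: "\<And>n x y. thin_family S d2 n x y \<Longrightarrow> (\<Sum>i<n. \<bar>g (y i) - g (x i)\<bar>) < e"
    by (rule abs_continuous_onE) blast
  have "(\<Sum>i<n. \<bar>h (y i) - h (x i)\<bar>) < \<epsilon>"
    if thin: "thin_family S (min d1 d2) n x y" for n x y
  proof -
    have xy: "\<forall>i<n. x i \<in> S \<and> y i \<in> S" using thin by (simp add: thin_family_def)
    let ?F = "\<Sum>i<n. \<bar>f (y i) - f (x i)\<bar>" and ?G = "\<Sum>i<n. \<bar>g (y i) - g (x i)\<bar>"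
    have "?F < e" "?G < e"
      by (auto intro!: d1 d2 thin_family_mono[OF thin])
    have "(\<Sum>i<n. \<bar>h (y i) - h (x i)\<bar>) \<le>
        (\<Sum>i<n. M * (\<bar>f (y i) - f (x i)\<bar> + \<bar>g (y i) - g (x i)\<bar>))"
      using xy by (intro sum_mono h) auto
    also have "\<dots> = M * (?F + ?G)"
      by (simp add: sum_distrib_left[symmetric] sum.distrib)
    also have "\<dots> \<le> (\<bar>M\<bar> + 1) * (?F + ?G)"
      by (intro mult_right_mono add_nonneg_nonneg sum_nonneg) auto
    also have "\<dots> < (\<bar>M\<bar> + 1) * (e + e)"
      using \<open>?F < e\<close> \<open>?G < e\<close> by (intro mult_strict_left_mono) auto
    also have "\<dots> = 2 * (\<bar>M\<bar> + 1) * e" by (simp add: algebra_simps)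
    also have "\<dots> = \<epsilon>" unfolding e_def by (simp add: add_nonneg_eq_0_iff)
    finally show ?thesis .
  qed
  then show "\<exists>\<delta>>0. \<forall>n x y. thin_family S \<delta> n x y \<longrightarrow> (\<Sum>i<n. \<bar>h (y i) - h (x i)\<bar>) < \<epsilon>"
    using \<open>d1 > 0\<close> \<open>d2 > 0\<close> by (intro exI[of _ "min d1 d2"]) auto
qed

lemma abs_continuous_on_ident: "abs_continuous_on S (\<lambda>x. x)"
  unfolding abs_continuous_on_iff_thin_family thin_family_def by auto

lemma abs_continuous_on_lipschitz:
  assumes "\<And>x y. x \<in> S \<Longrightarrow> y \<in> S \<Longrightarrow> \<bar>h y - h x\<bar> \<le> M * \<bar>y - x\<bar>"
  shows "abs_continuous_on S h"
  using assms
  by (intro abs_continuous_on_dominated[OF abs_continuous_on_ident abs_continuous_on_ident,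
        of S h "M / 2"]) (simp add: algebra_simps)

lemma abs_continuous_on_diff:
  assumes "abs_continuous_on S f" "abs_continuous_on S g"
  shows "abs_continuous_on S (\<lambda>x. f x - g x)"
  by (rule abs_continuous_on_dominated[OF assms, where M = 1]) (simp; linarith)

lemma abs_continuous_on_mult:
  assumes f: "abs_continuous_on S f" and g: "abs_continuous_on S g"
    and "bounded (f ` S)" "bounded (g ` S)"
  shows "abs_continuous_on S (\<lambda>x. f x * g x)"
proof -
  obtain A B where A: "\<And>x. x \<in> S \<Longrightarrow> \<bar>f x\<bar> \<le> A" and B: "\<And>x. x \<in> S \<Longrightarrow> \<bar>g x\<bar> \<le> B"
    using assms(3,4) unfolding bounded_iff by auto
  show ?thesis
  proof (rule abs_continuous_on_dominated[OF f g])
    fix x y assume xy: "x \<in> S" "y \<in> S"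
    have "f y * g y - f x * g x = (f y - f x) * g y + f x * (g y - g x)"
      by (simp add: algebra_simps)
    then have "\<bar>f y * g y - f x * g x\<bar> \<le> \<bar>f y - f x\<bar> * \<bar>g y\<bar> + \<bar>f x\<bar> * \<bar>g y - g x\<bar>"
      by (metis abs_mult abs_triangle_ineq)
    also have "\<dots> \<le> \<bar>f y - f x\<bar> * max A B + max A B * \<bar>g y - g x\<bar>"
      using A[OF xy(1)] B[OF xy(2)] by (intro add_mono mult_left_mono mult_right_mono) auto
    finally show "\<bar>f y * g y - f x * g x\<bar> \<le> max A B * (\<bar>f y - f x\<bar> + \<bar>g y - g x\<bar>)"
      by (simp add: algebra_simps)
  qed
qed

lemma abs_continuous_on_imp_continuous_on:
  assumes "abs_continuous_on S f"
  shows "continuous_on S f"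
  unfolding continuous_on_iff
proof (intro ballI allI impI)
  fix x \<epsilon> :: real assume "x \<in> S" "\<epsilon> > 0"
  from assms \<open>\<epsilon> > 0\<close> obtain \<delta> where "\<delta> > 0"
      and \<delta>: "\<And>n x y. thin_family S \<delta> n x y \<Longrightarrow> (\<Sum>i<n. \<bar>f (y i) - f (x i)\<bar>) < \<epsilon>"
      by (rule abs_continuous_onE) blast
  have "dist (f y) (f x) < \<epsilon>" if "y \<in> S" "dist y x < \<delta>" for y
  proof (cases "x \<le> y")
    case True
    then show ?thesis
      using \<delta>[of 1 "\<lambda>_. x" "\<lambda>_. y"] that \<open>x \<in> S\<close> by (simp add: thin_family_def dist_real_def)
  next
    case False
    then show ?thesis
      using \<delta>[of 1 "\<lambda>_. y" "\<lambda>_. x"] that \<open>x \<in> S\<close>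
      by (simp add: thin_family_def dist_real_def abs_minus_commute)
  qed
  then show "\<exists>d>0. \<forall>x'\<in>S. dist x' x < d \<longrightarrow> dist (f x') (f x) < \<epsilon>"
    using \<open>\<delta> > 0\<close> by blast
qed

text \<open>The chord has to straddle \<open>x\<close>, as the pieces of a tagged division do around their tags:
  differentiability at the single point \<open>x\<close> does not control chords between two points on the same
  side of it.\<close>

lemma real_derivative_lower_slope:
  fixes f :: "real \<Rightarrow> real"
  assumes "(f has_real_derivative w) (at x within S)" "\<epsilon> > 0"
  shows "\<exists>d>0. \<forall>y\<in>S. \<forall>z\<in>S. z \<le> x \<and> x \<le> y \<and> y \<in> ball x d \<and> z \<in> ball x d
    \<longrightarrow> (w - \<epsilon>) * (y - z) \<le> f y - f z"
proof -
  from assms obtain d where "d > 0"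
    and d: "\<And>y. y \<in> S \<Longrightarrow> \<bar>y - x\<bar> < d \<Longrightarrow> \<bar>f y - f x - w * (y - x)\<bar> \<le> \<epsilon> * \<bar>y - x\<bar>"
    unfolding has_field_derivative_def has_derivative_within_alt real_norm_def by metis
  have "(w - \<epsilon>) * (y - z) \<le> f y - f z"
    if "y \<in> S" "z \<in> S" "z \<le> x" "x \<le> y" "y \<in> ball x d" "z \<in> ball x d" for y z
    using d[of y] d[of z] that by (simp add: dist_real_def abs_le_iff algebra_simps)
  then show ?thesis using \<open>d > 0\<close> by blast
qed

lemma AE_lebesgue_onE:
  assumes "AE t in lebesgue_on S. P t" "S \<in> sets lebesgue"
  obtains N where "N \<in> null_sets lebesgue" "\<And>t. t \<in> S \<Longrightarrow> t \<notin> N \<Longrightarrow> P t"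
proof -
  have "AE t in lebesgue. t \<in> S \<longrightarrow> P t"
    using assms by (simp add: AE_restrict_space_iff)
  then show ?thesis by (elim AE_E3) (use that in auto)
qed

lemma AE_lebesgue_on_subset:
  assumes "AE t in lebesgue_on S. P t" "R \<subseteq> S" "S \<in> sets lebesgue" "R \<in> sets lebesgue"
  shows "AE t in lebesgue_on R. P t"
  using assms by (auto simp: AE_restrict_space_iff elim!: eventually_mono)

text \<open>Cousin's covering argument. The exceptional null set \<open>N\<close> lies in an open set \<open>U\<close> of
  measure below \<open>\<delta>\<close>. Take a gauge that confines the pieces tagged in \<open>N\<close> to \<open>U\<close>, and the other
  pieces to neighbourhoods of their tags in which chords around the tag have slope at least \<open>-\<epsilon>\<close>. In a fine tagged division,
  the pieces tagged in \<open>N\<close> have total length below \<open>\<delta>\<close>, so by absolute continuity they contribute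
  at most \<open>\<epsilon>\<close> in absolute value; the others contribute at least \<open>-\<epsilon> (b - a)\<close>.\<close>

lemma abs_continuous_on_increment_nonneg:
  fixes f :: "real \<Rightarrow> real"
  assumes ab: "a \<le> b" and ac: "abs_continuous_on {a..b} f"
    and deriv: "AE t in lebesgue_on {a..b}.
      \<exists>w. (f has_real_derivative w) (at t within {a..b}) \<and> 0 \<le> w"
  shows "f a \<le> f b"
proof -
  obtain N where null: "N \<in> null_sets lebesgue"
    and N: "\<And>t. t \<in> {a..b} \<Longrightarrow> t \<notin> N \<Longrightarrow>
      \<exists>w. (f has_real_derivative w) (at t within {a..b}) \<and> 0 \<le> w"
    by (rule AE_lebesgue_onE[OF deriv]) auto
  have main: "f a \<le> f b + \<epsilon> * (b - a + 1)" if "\<epsilon> > 0" for \<epsilon>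
  proof -
    from ac that obtain \<delta> where "\<delta> > 0"
      and \<delta>: "\<And>n x y. thin_family {a..b} \<delta> n x y \<Longrightarrow> (\<Sum>i<n. \<bar>f (y i) - f (x i)\<bar>) < \<epsilon>"
      by (rule abs_continuous_onE) blast
    obtain U where U: "open U" "N \<subseteq> U" "emeasure lebesgue (U - N) < ennreal \<delta>"
      using sets_lebesgue_outer_open[of N \<delta>] null \<open>\<delta> > 0\<close> by blast
    have emU: "emeasure lebesgue U < ennreal \<delta>"
      using emeasure_Diff_null_set[OF null, of U] U by simp
    have "\<forall>x. \<exists>d>0. x \<in> {a..b} - N \<longrightarrow> (\<forall>y\<in>{a..b}. \<forall>z\<in>{a..b}.
        z \<le> x \<and> x \<le> y \<and> y \<in> ball x d \<and> z \<in> ball x d \<longrightarrow> - \<epsilon> * (y - z) \<le> f y - f z)"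
    proof
      fix x
      show "\<exists>d>0. x \<in> {a..b} - N \<longrightarrow> (\<forall>y\<in>{a..b}. \<forall>z\<in>{a..b}.
        z \<le> x \<and> x \<le> y \<and> y \<in> ball x d \<and> z \<in> ball x d \<longrightarrow> - \<epsilon> * (y - z) \<le> f y - f z)"
      proof (cases "x \<in> {a..b} - N")
        case True
        with N obtain w where w: "(f has_real_derivative w) (at x within {a..b})" "0 \<le> w"
          by blast
        have "- \<epsilon> * (y - z) \<le> (w - \<epsilon>) * (y - z)" if "z \<le> x" "x \<le> y" for y z
          using w(2) that by (intro mult_right_mono) auto
        then show ?thesis
          using real_derivative_lower_slope[OF w(1) \<open>\<epsilon> > 0\<close>] by (meson order_trans)
      qed (auto intro: exI[of _ 1])
    qed
    then obtain d where d: "\<And>x. d x > 0"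
      "\<And>x y z. x \<in> {a..b} - N \<Longrightarrow> y \<in> {a..b} \<Longrightarrow> z \<in> {a..b} \<Longrightarrow> z \<le> x \<Longrightarrow> x \<le> y \<Longrightarrow>
          y \<in> ball x (d x) \<Longrightarrow> z \<in> ball x (d x) \<Longrightarrow> - \<epsilon> * (y - z) \<le> f y - f z"
      by metis
    define g where "g = (\<lambda>x. if x \<in> N then U else ball x (d x))"
    have "gauge g"
      unfolding gauge_def g_def using U d(1) by auto
    then obtain p where p: "p tagged_division_of {a..b}" and fine: "g fine p"
      by (rule fine_division_exists_real)
    have piece: "Inf K \<in> {a..b} \<and> Sup K \<in> {a..b} \<and> Inf K \<le> x \<and> x \<le> Sup K \<and> K = {Inf K..Sup K}
        \<and> K \<subseteq> g x \<and> x \<in> {a..b}" if xK: "(x, K) \<in> p" for x K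
    proof -
      obtain c e where K: "K = {c..e}" using tagged_division_ofD(4)[OF p xK] by auto
      have "x \<in> K" "K \<subseteq> {a..b}" using tagged_division_ofD(2,3)[OF p xK] .
      moreover have "K \<subseteq> g x" using fine xK by (auto simp: fine_def)
      ultimately show ?thesis using K by auto
    qed
    \<comment> \<open>The pieces tagged in \<open>N\<close>, enumerated so that absolute continuity applies to them.\<close>
    define q where "q = {xK \<in> p. fst xK \<in> N}"
    have "finite p" using p by blast
    then have "finite q" by (simp add: q_def)
    let ?len = "\<lambda>(x::real, K). Sup K - Inf K :: real"
    let ?inc = "\<lambda>(x::real, K). f (Sup K) - f (Inf K)"
    obtain h where h: "bij_betw h {..<card q} q"
      using ex_bij_betw_nat_finite[OF \<open>finite q\<close>] by (auto simp: atLeast0LessThan)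
    define x where "x i = Inf (snd (h i))" for i
    define y where "y i = Sup (snd (h i))" for i
    have hq: "h i \<in> q" if "i < card q" for i
      using h that by (auto simp: bij_betw_def)
    then have hp: "(fst (h i), snd (h i)) \<in> p" "fst (h i) \<in> N" if "i < card q" for i
      using that by (auto simp: q_def)
    have xy: "x i \<in> {a..b} \<and> y i \<in> {a..b} \<and> x i \<le> y i" if "i < card q" for i
      using piece[OF hp(1)[OF that]] unfolding x_def y_def by auto
    have interior: "{x i<..<y i} = interior (snd (h i))" if "i < card q" for i
      using piece[OF hp(1)[OF that]] unfolding x_def y_def by (metis interior_atLeastAtMost_real)
    have disj: "{x i<..<y i} \<inter> {x j<..<y j} = {}" if "i < card q" "j < card q" "i \<noteq> j" for i j
    proof -
      have "h i \<noteq> h j" using h that unfolding bij_betw_def inj_on_def by auto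
      then have "(fst (h i), snd (h i)) \<noteq> (fst (h j), snd (h j))" by simp
      then show ?thesis
        using tagged_division_ofD(5)[OF p hp(1)[OF that(1)] hp(1)[OF that(2)]] interior that
        by simp
    qed
    have sub: "{x i<..<y i} \<subseteq> U" if "i < card q" for i
    proof -
      have "snd (h i) \<subseteq> U" using piece[OF hp(1)[OF that]] hp(2)[OF that] by (auto simp: g_def)
      then show ?thesis using interior[OF that] interior_subset by blast
    qed
    have "(\<Sum>i<card q. y i - x i) = (\<Sum>i<card q. measure lebesgue {x i<..<y i})"
      using xy by (intro sum.cong) auto
    also have "\<dots> = measure lebesgue (\<Union>i<card q. {x i<..<y i})"
      using disj xy by (intro measure_finite_Union[symmetric]) (auto simp: disjoint_family_on_def)
    also have "\<dots> \<le> measure lebesgue U"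
      using sub U(1) emU
      by (intro measure_mono_fmeasurable) (auto simp: fmeasurable_def less_top[symmetric])
    also have "\<dots> < \<delta>"
    proof -
      have "emeasure lebesgue U = ennreal (measure lebesgue U)"
        using emU by (intro emeasure_eq_ennreal_measure) auto
      with emU show ?thesis by (simp add: ennreal_less_iff)
    qed
    finally have "(\<Sum>i<card q. \<bar>f (y i) - f (x i)\<bar>) < \<epsilon>"
      using xy disj by (intro \<delta>) (auto simp: thin_family_def)
    also have "(\<Sum>i<card q. \<bar>f (y i) - f (x i)\<bar>) = (\<Sum>xK\<in>q. \<bar>?inc xK\<bar>)"
      using sum.reindex_bij_betw[OF h, of "\<lambda>xK. \<bar>?inc xK\<bar>"]
      by (simp add: x_def y_def case_prod_unfold)
    finally have bad: "(\<Sum>xK\<in>q. \<bar>?inc xK\<bar>) < \<epsilon>" .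
    have "- \<epsilon> * (b - a) = (\<Sum>xK\<in>p. - \<epsilon> * ?len xK)"
      using additive_tagged_division_1[OF ab p, of "\<lambda>t. t"]
      by (simp only: sum_distrib_left[symmetric])
    also have "\<dots> = (\<Sum>xK\<in>p - q. - \<epsilon> * ?len xK) + (\<Sum>xK\<in>q. - \<epsilon> * ?len xK)"
      using \<open>finite p\<close> by (intro sum.subset_diff) (auto simp: q_def)
    also have "\<dots> \<le> (\<Sum>xK\<in>p - q. ?inc xK) + (\<Sum>xK\<in>q. 0)"
    proof (intro add_mono sum_mono)
      fix xK assume "xK \<in> p - q"
      then obtain t K where tK: "xK = (t, K)" "(t, K) \<in> p" "t \<notin> N"
        by (cases xK) (auto simp: q_def)
      note P = piece[OF tK(2)]
      have "Inf K \<in> K" "Sup K \<in> K" using P by (metis atLeastAtMost_iff order_trans order_refl)+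
      then have "Inf K \<in> ball t (d t)" "Sup K \<in> ball t (d t)"
        using P tK(3) unfolding g_def by auto
      then show "- \<epsilon> * ?len xK \<le> ?inc xK"
        using d(2)[of t "Sup K" "Inf K"] P tK by simp
    next
      fix xK assume "xK \<in> q"
      then obtain t K where tK: "xK = (t, K)" "(t, K) \<in> p" by (cases xK) (auto simp: q_def)
      with piece[OF tK(2)] \<open>\<epsilon> > 0\<close> show "- \<epsilon> * ?len xK \<le> 0" by simp
    qed
    also have "\<dots> \<le> (\<Sum>xK\<in>p - q. ?inc xK) + (\<Sum>xK\<in>q. ?inc xK + \<bar>?inc xK\<bar>)"
      by (intro add_mono sum_mono order_refl) linarith
    also have "\<dots> = (\<Sum>xK\<in>p. ?inc xK) + (\<Sum>xK\<in>q. \<bar>?inc xK\<bar>)"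
      using sum.subset_diff[of q p ?inc] \<open>finite p\<close> by (simp add: q_def sum.distrib)
    also have "(\<Sum>xK\<in>p. ?inc xK) = f b - f a"
      by (rule additive_tagged_division_1[OF ab p])
    finally show ?thesis using bad by (simp add: algebra_simps)
  qed
  show ?thesis
  proof (rule field_le_epsilon)
    fix e :: real assume "e > 0"
    then show "f a \<le> f b + e"
      using main[of "e / (b - a + 1)"] ab by simp
  qed
qed

lemma abs_continuous_on_increment_ge:
  fixes f :: "real \<Rightarrow> real"
  assumes ab: "a \<le> b" and ac: "abs_continuous_on {a..b} f"
    and deriv: "AE t in lebesgue_on {a..b}.
      \<exists>w. (f has_real_derivative w) (at t within {a..b}) \<and> m \<le> w"
  shows "m * (b - a) \<le> f b - f a"
proof -
  have "f a - m * a \<le> f b - m * b"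
  proof (rule abs_continuous_on_increment_nonneg[OF ab, of "\<lambda>t. f t - m * t"])
    show "abs_continuous_on {a..b} (\<lambda>t. f t - m * t)"
    proof (rule abs_continuous_on_diff[OF ac])
      show "abs_continuous_on {a..b} ((*) m)"
        by (rule abs_continuous_on_lipschitz[where M = "\<bar>m\<bar>"])
           (simp flip: right_diff_distrib abs_mult)
    qed
    show "AE t in lebesgue_on {a..b}. \<exists>w.
        ((\<lambda>t. f t - m * t) has_real_derivative w) (at t within {a..b}) \<and> 0 \<le> w"
      using deriv
    proof (rule eventually_mono)
      fix t assume "\<exists>w. (f has_real_derivative w) (at t within {a..b}) \<and> m \<le> w"
      then obtain w where "(f has_real_derivative w) (at t within {a..b})" "m \<le> w" by blast
      then show "\<exists>w. ((\<lambda>t. f t - m * t) has_real_derivative w) (at t within {a..b}) \<and> 0 \<le> w"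
        by (intro exI[of _ "w - m"]) (auto intro!: derivative_eq_intros)
    qed
  qed
  then show ?thesis by (simp add: algebra_simps)
qed

section \<open>Solutions of Hill's equation\<close>

lemma hill_solution_diff:
  assumes 1: "hill_solution L a \<sigma>1 u1 v1" and 2: "hill_solution L a \<sigma>2 u2 v2"
  shows "hill_solution L a (\<lambda>t. \<sigma>1 t - \<sigma>2 t) (\<lambda>t. u1 t - u2 t) (\<lambda>t. v1 t - v2 t)"
  unfolding hill_solution_def
proof (intro conjI ballI)
  have "AE t in lebesgue_on {0..L}.
        \<exists>w. (v1 has_real_derivative w) (at t within {0..L}) \<and> w + a t * u1 t = \<sigma>1 t"
    and "AE t in lebesgue_on {0..L}.
        \<exists>w. (v2 has_real_derivative w) (at t within {0..L}) \<and> w + a t * u2 t = \<sigma>2 t"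
    using 1 2 by (auto simp: hill_solution_def)
  then show "AE t in lebesgue_on {0..L}. \<exists>w.
      ((\<lambda>t. v1 t - v2 t) has_real_derivative w) (at t within {0..L}) \<and>
      w + a t * (u1 t - u2 t) = \<sigma>1 t - \<sigma>2 t"
  proof eventually_elim
    fix t
    assume "\<exists>w. (v1 has_real_derivative w) (at t within {0..L}) \<and> w + a t * u1 t = \<sigma>1 t"
      and "\<exists>w. (v2 has_real_derivative w) (at t within {0..L}) \<and> w + a t * u2 t = \<sigma>2 t"
    then obtain w1 w2 where
      "(v1 has_real_derivative w1) (at t within {0..L})" "w1 + a t * u1 t = \<sigma>1 t"
      "(v2 has_real_derivative w2) (at t within {0..L})" "w2 + a t * u2 t = \<sigma>2 t" by blast
    then show "\<exists>w. ((\<lambda>t. v1 t - v2 t) has_real_derivative w) (at t within {0..L}) \<and>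
      w + a t * (u1 t - u2 t) = \<sigma>1 t - \<sigma>2 t"
      by (intro exI[of _ "w1 - w2"]) (auto intro!: derivative_eq_intros simp: algebra_simps)
  qed
qed (use 1 2 in \<open>auto simp: hill_solution_def intro: abs_continuous_on_diff DERIV_diff\<close>)

lemma hill_solution_zero: "hill_solution L a (\<lambda>_. 0) (\<lambda>_. 0) (\<lambda>_. 0)"
  unfolding hill_solution_def
  by (auto intro!: abs_continuous_on_lipschitz[where M = 0] exI[of _ 0])

lemma hill_solution_minus:
  assumes "hill_solution L a \<sigma> u v"
  shows "hill_solution L a (\<lambda>t. - \<sigma> t) (\<lambda>t. - u t) (\<lambda>t. - v t)"
  using hill_solution_diff[OF hill_solution_zero assms] by simp

lemma hill_solution_restrict:
  assumes hill: "hill_solution L b \<sigma> u v" and K: "K \<le> L"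
    and ab: "\<And>t. t \<in> {0..K} \<Longrightarrow> b t = a t"
  shows "hill_solution K a \<sigma> u v"
proof -
  have sub: "{0..K} \<subseteq> {0..L}" using K by auto
  have "AE t in lebesgue_on {0..K}. t \<in> {0..K}"
    by (simp add: AE_restrict_space_iff)
  moreover have "AE t in lebesgue_on {0..K}.
      \<exists>w. (v has_real_derivative w) (at t within {0..L}) \<and> w + b t * u t = \<sigma> t"
    using hill by (intro AE_lebesgue_on_subset[OF _ sub]) (auto simp: hill_solution_def)
  ultimately have "AE t in lebesgue_on {0..K}.
      \<exists>w. (v has_real_derivative w) (at t within {0..K}) \<and> w + a t * u t = \<sigma> t"
    by eventually_elim (metis ab sub DERIV_subset)
  then show ?thesis
    using hill sub unfolding hill_solution_def
    by (meson DERIV_subset abs_continuous_on_subset subsetD)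
qed

lemma hill_solution_continuous:
  assumes "hill_solution L a \<sigma> u v"
  shows "continuous_on {0..L} u" "continuous_on {0..L} v"
  using assms unfolding hill_solution_def
  by (auto intro: DERIV_continuous_on abs_continuous_on_imp_continuous_on)

lemma hill_solution_abs_continuous:
  assumes hill: "hill_solution L a \<sigma> u v"
  shows "abs_continuous_on {0..L} u"
proof -
  have "bounded (v ` {0..L})"
    using hill_solution_continuous[OF hill] by (simp add: compact_imp_bounded compact_continuous_image)
  then obtain M where M: "\<And>t. t \<in> {0..L} \<Longrightarrow> \<bar>v t\<bar> \<le> M"
    unfolding bounded_iff real_norm_def by blast
  show ?thesis
  proof (rule abs_continuous_on_lipschitz[where M = M])
    fix x y assume "x \<in> {0..L}" "y \<in> {0..L}"
    then show "\<bar>u y - u x\<bar> \<le> M * \<bar>y - x\<bar>"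
      using field_differentiable_bound[of "{0..L}" u v M y x] M hill
      by (auto simp: hill_solution_def)
  qed
qed

lemma thin_family_reflect:
  assumes "thin_family {0..L} \<delta> n x y"
  shows "thin_family {0..L} \<delta> n (\<lambda>i. L - y i) (\<lambda>i. L - x i)"
proof -
  have "{L - y i<..<L - x i} \<inter> {L - y j<..<L - x j} = {}" if "i < n" "j < n" "i \<noteq> j" for i j
  proof -
    have "{x i<..<y i} \<inter> {x j<..<y j} = {}" using assms[unfolded thin_family_def] that by blast
    moreover have "L - t \<in> {x i<..<y i} \<inter> {x j<..<y j}"
      if "t \<in> {L - y i<..<L - x i} \<inter> {L - y j<..<L - x j}" for t
      using that by auto
    ultimately show ?thesis by blast
  qed
  then show ?thesis using assms unfolding thin_family_def by auto
qed

lemma abs_continuous_on_reflect: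
  assumes "abs_continuous_on {0..L} f"
  shows "abs_continuous_on {0..L} (\<lambda>t. - f (L - t))"
  unfolding abs_continuous_on_iff_thin_family
proof (intro allI impI)
  fix \<epsilon> :: real assume "\<epsilon> > 0"
  with assms obtain \<delta> where "\<delta> > 0"
    and \<delta>: "\<And>n x y. thin_family {0..L} \<delta> n x y \<Longrightarrow> (\<Sum>i<n. \<bar>f (y i) - f (x i)\<bar>) < \<epsilon>"
    by (rule abs_continuous_onE) blast
  show "\<exists>\<delta>>0. \<forall>n x y. thin_family {0..L} \<delta> n x y \<longrightarrow>
      (\<Sum>i<n. \<bar>- f (L - y i) - - f (L - x i)\<bar>) < \<epsilon>"
    using \<open>\<delta> > 0\<close> \<delta>[OF thin_family_reflect] by (intro exI[of _ \<delta>]) simp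
qed

lemma has_real_derivative_reflect:
  assumes "(f has_real_derivative D) (at (L - t) within {0..L})"
  shows "((\<lambda>t. f (L - t)) has_real_derivative - D) (at t within {0..L})"
proof -
  have "(\<lambda>t. L - t) ` {0..L} = {0..L}"
    by (auto simp: image_iff intro!: bexI[of _ "L - _"])
  moreover have "((\<lambda>t. L - t) has_real_derivative -1) (at t within {0..L})"
    by (auto intro!: derivative_eq_intros)
  ultimately show ?thesis
    using DERIV_image_chain[of f D "\<lambda>t. L - t" t "{0..L}" "-1"] assms
    by (simp add: o_def)
qed

lemma AE_lebesgue_on_reflect:
  fixes L :: real
  assumes "AE t in lebesgue_on {0..L}. P t"
  shows "AE t in lebesgue_on {0..L}. P (L - t)"
proof -
  obtain N where null: "N \<in> null_sets lebesgue"
    and N: "\<And>t. t \<in> {0..L} \<Longrightarrow> t \<notin> N \<Longrightarrow> P t"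
    by (rule AE_lebesgue_onE[OF assms]) auto
  have "negligible ((\<lambda>t. L - t) ` N)"
    using null by (intro negligible_differentiable_image_negligible)
      (auto simp: negligible_iff_null_sets intro!: derivative_intros)
  then have "AE t in lebesgue. t \<notin> (\<lambda>t. L - t) ` N"
    by (auto simp: negligible_iff_null_sets intro: AE_not_in)
  moreover have "t \<in> {0..L} \<longrightarrow> P (L - t)" if "t \<notin> (\<lambda>t. L - t) ` N" for t
    using that N[of "L - t"] by (force simp: image_iff)
  ultimately show ?thesis
    by (subst AE_restrict_space_iff) (auto elim!: eventually_mono)
qed

text \<open>Used with the even potential on \<open>[0,2T]\<close>, which the reflection leaves unchanged.\<close>

lemma hill_solution_reflect:
  assumes hill: "hill_solution L a \<sigma> u v"
  shows "hill_solution L (\<lambda>t. a (L - t)) (\<lambda>t. \<sigma> (L - t)) (\<lambda>t. u (L - t)) (\<lambda>t. - v (L - t))"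
  unfolding hill_solution_def
proof (intro conjI ballI)
  show "((\<lambda>t. u (L - t)) has_real_derivative - v (L - t)) (at t within {0..L})"
    if "t \<in> {0..L}" for t
    using hill that by (intro has_real_derivative_reflect) (auto simp: hill_solution_def)
  show "abs_continuous_on {0..L} (\<lambda>t. - v (L - t))"
    using hill by (intro abs_continuous_on_reflect) (auto simp: hill_solution_def)
  have "AE t in lebesgue_on {0..L}. \<exists>w.
      (v has_real_derivative w) (at (L - t) within {0..L}) \<and> w + a (L - t) * u (L - t) = \<sigma> (L - t)"
    using hill by (intro AE_lebesgue_on_reflect) (simp add: hill_solution_def)
  then show "AE t in lebesgue_on {0..L}. \<exists>w.
      ((\<lambda>t. - v (L - t)) has_real_derivative w) (at t within {0..L}) \<and>
      w + a (L - t) * u (L - t) = \<sigma> (L - t)"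
  proof (rule eventually_mono)
    fix t assume "\<exists>w. (v has_real_derivative w) (at (L - t) within {0..L}) \<and>
      w + a (L - t) * u (L - t) = \<sigma> (L - t)"
    then obtain w where "(v has_real_derivative w) (at (L - t) within {0..L})"
      and w: "w + a (L - t) * u (L - t) = \<sigma> (L - t)" by blast
    then have "((\<lambda>t. - v (L - t)) has_real_derivative w) (at t within {0..L})"
      using DERIV_minus[OF has_real_derivative_reflect] by fastforce
    with w show "\<exists>w. ((\<lambda>t. - v (L - t)) has_real_derivative w) (at t within {0..L}) \<and>
      w + a (L - t) * u (L - t) = \<sigma> (L - t)" by blast
  qed
qed

section \<open>A maximum principle\<close>

text \<open>A positive maximum of \<open>q = u / \<phi>\<close> at \<open>c\<close> is refuted by the Wronskian \<open>W = u' \<phi> - u \<phi>'\<close>, the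
  numerator of \<open>q'\<close>: it vanishes at \<open>c\<close> and increases strictly near \<open>c\<close>, so \<open>q\<close> would exceed
  \<open>q c\<close> beside \<open>c\<close>. A maximum at \<open>T\<close> leaves only the alternative \<open>u' T = 0\<close>, and there
  \<open>\<phi>' T = 0\<close> makes \<open>W\<close> vanish as well.\<close>

lemma maximum_principle:
  assumes T: "T > 0"
    and \<phi>: "hill_solution T a (\<lambda>_. -1) \<phi> \<psi>"
    and \<phi>_pos: "\<forall>t\<in>{0..T}. \<phi> t > 0" and \<psi>: "\<psi> 0 = 0" "\<psi> T = 0"
    and u: "hill_solution T a \<sigma> u v" and \<sigma>: "AE t in lebesgue_on {0..T}. 0 \<le> \<sigma> t"
    and v0: "v 0 = 0" and right: "u T \<le> 0 \<or> v T = 0"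
    and t: "t \<in> {0..T}"
  shows "u t \<le> 0"
proof (rule ccontr)
  assume "\<not> u t \<le> 0"
  note pos = \<phi>_pos[rule_format]
  define q where "q t = u t / \<phi> t" for t
  define W where "W t = v t * \<phi> t - u t * \<psi> t" for t
  note cont = hill_solution_continuous[OF u] hill_solution_continuous[OF \<phi>]
  have du: "(u has_real_derivative v s) (at s within {0..T})"
    and d\<phi>: "(\<phi> has_real_derivative \<psi> s) (at s within {0..T})" if "s \<in> {0..T}" for s
    using u \<phi> that by (auto simp: hill_solution_def)
  have contq: "continuous_on {0..T} q"
    unfolding q_def using cont pos by (intro continuous_on_divide) fastforce+
  have dq: "(q has_real_derivative W s / (\<phi> s)\<^sup>2) (at s within {0..T})" if "s \<in> {0..T}" for s
    unfolding q_def W_def using du[OF that] d\<phi>[OF that] pos[OF that]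
    by (auto intro!: derivative_eq_intros simp: power2_eq_square)
  have bdd: "bounded (f ` {0..T})" if "continuous_on {0..T} f" for f :: "real \<Rightarrow> real"
    using that by (simp add: compact_imp_bounded compact_continuous_image)
  have acW: "abs_continuous_on {0..T} W"
    unfolding W_def using u \<phi> cont
    by (intro abs_continuous_on_diff abs_continuous_on_mult bdd
          hill_solution_abs_continuous[OF u] hill_solution_abs_continuous[OF \<phi>])
       (simp_all add: hill_solution_def)
  have in_I: "AE s in lebesgue_on {0..T}. s \<in> {0..T}"
    by (simp add: AE_restrict_space_iff)
  have v': "AE s in lebesgue_on {0..T}.
      \<exists>w. (v has_real_derivative w) (at s within {0..T}) \<and> w + a s * u s = \<sigma> s"
    and \<psi>': "AE s in lebesgue_on {0..T}.
      \<exists>w. (\<psi> has_real_derivative w) (at s within {0..T}) \<and> w + a s * \<phi> s = -1"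
    using u \<phi> by (auto simp: hill_solution_def)
  have dW: "AE s in lebesgue_on {0..T}.
      \<exists>w. (W has_real_derivative w) (at s within {0..T}) \<and> u s \<le> w"
    using in_I v' \<psi>' \<sigma>
  proof eventually_elim
    fix s
    assume s: "s \<in> {0..T}" and "0 \<le> \<sigma> s"
      and "\<exists>w. (v has_real_derivative w) (at s within {0..T}) \<and> w + a s * u s = \<sigma> s"
      and "\<exists>w. (\<psi> has_real_derivative w) (at s within {0..T}) \<and> w + a s * \<phi> s = -1"
    then obtain w1 w2 where
      w1: "(v has_real_derivative w1) (at s within {0..T})" "w1 + a s * u s = \<sigma> s" and
      w2: "(\<psi> has_real_derivative w2) (at s within {0..T})" "w2 + a s * \<phi> s = -1" by blast
    have w: "w1 = \<sigma> s - a s * u s" "w2 = - 1 - a s * \<phi> s" using w1 w2 by auto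
    have "(W has_real_derivative \<sigma> s * \<phi> s + u s) (at s within {0..T})"
      unfolding W_def using w1(1) w2(1) du[OF s] d\<phi>[OF s]
      by (auto intro!: derivative_eq_intros simp: w algebra_simps)
    moreover have "0 \<le> \<sigma> s * \<phi> s" using \<open>0 \<le> \<sigma> s\<close> pos[OF s] by simp
    ultimately show "\<exists>w. (W has_real_derivative w) (at s within {0..T}) \<and> u s \<le> w"
      by (intro exI[of _ "\<sigma> s * \<phi> s + u s"]) auto
  qed
  obtain c where c: "c \<in> {0..T}" and max: "\<And>s. s \<in> {0..T} \<Longrightarrow> q s \<le> q c"
    using continuous_attains_sup[OF _ _ contq] t by (metis compact_Icc empty_iff)
  have "0 < q t" using \<open>\<not> u t \<le> 0\<close> pos[OF t] by (simp add: q_def)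
  then have "0 < q c" using max[OF t] by linarith
  then have "u c > 0" using pos[OF c] by (simp add: q_def zero_less_divide_iff)
  have dq_open: "DERIV q s :> W s / (\<phi> s)\<^sup>2" if s: "0 < s" "s < T" for s
  proof -
    have "at s within {0..T} = at s" using s by (intro at_within_interior) simp
    then show ?thesis using dq[of s] s by simp
  qed
  have Wc: "W c = 0"
  proof -
    consider "c = 0" | "c = T" | "c \<in> {0<..<T}" using c by fastforce
    then show ?thesis
    proof cases
      case 1
      then show ?thesis using v0 \<psi> by (simp add: W_def)
    next
      case 2
      then show ?thesis using right \<open>u c > 0\<close> \<psi> by (simp add: W_def)
    next
      case 3
      then have der: "DERIV q c :> W c / (\<phi> c)\<^sup>2"
        by (intro dq_open) auto
      have le: "\<forall>s. \<bar>c - s\<bar> < min c (T - c) \<longrightarrow> q s \<le> q c"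
        by (intro allI impI max) (simp add: abs_less_iff)
      have "W c / (\<phi> c)\<^sup>2 = 0"
        by (rule DERIV_local_max[OF der _ le]) (use 3 in auto)
      then show ?thesis using pos[OF c] by simp
    qed
  qed
  \<comment> \<open>Near \<open>c\<close> the solution stays above \<open>m\<close>. This bounds \<open>W'\<close> below by a positive constant,
    which the increment estimate turns into strict monotonicity of \<open>W\<close>.\<close>
  define m where "m = u c / 2"
  have "m > 0" using \<open>u c > 0\<close> by (simp add: m_def)
  with cont(1) c obtain r where "r > 0"
    and r: "\<And>s. s \<in> {0..T} \<Longrightarrow> \<bar>s - c\<bar> < r \<Longrightarrow> \<bar>u s - u c\<bar> < m"
    unfolding continuous_on_iff dist_real_def by meson
  have incr: "m * (y - x) \<le> W y - W x"
    if "x \<le> y" "0 \<le> x" "y \<le> T" "\<bar>x - c\<bar> < r" "\<bar>y - c\<bar> < r" for x y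
  proof (rule abs_continuous_on_increment_ge[OF \<open>x \<le> y\<close>])
    have sub: "{x..y} \<subseteq> {0..T}" using that by auto
    show "abs_continuous_on {x..y} W" by (rule abs_continuous_on_subset[OF acW sub])
    have "AE s in lebesgue_on {x..y}. s \<in> {x..y}" by (simp add: AE_restrict_space_iff)
    moreover have "AE s in lebesgue_on {x..y}.
        \<exists>w. (W has_real_derivative w) (at s within {0..T}) \<and> u s \<le> w"
      by (rule AE_lebesgue_on_subset[OF dW sub]) auto
    ultimately show "AE s in lebesgue_on {x..y}.
        \<exists>w. (W has_real_derivative w) (at s within {x..y}) \<and> m \<le> w"
    proof eventually_elim
      fix s assume s: "s \<in> {x..y}"
        and "\<exists>w. (W has_real_derivative w) (at s within {0..T}) \<and> u s \<le> w"
      then obtain w where w: "(W has_real_derivative w) (at s within {0..T})" "u s \<le> w" by blast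
      have "\<bar>u s - u c\<bar> < m" using s that by (intro r) auto
      then have "m \<le> w" using w(2) unfolding m_def by linarith
      then show "\<exists>w. (W has_real_derivative w) (at s within {x..y}) \<and> m \<le> w"
        using DERIV_subset[OF w(1) sub] by blast
    qed
  qed
  show False
  proof (cases "c < T")
    case True
    define d where "d = min T (c + r / 2)"
    have d: "c < d" "d \<le> T" "d - c < r" using True \<open>r > 0\<close> by (auto simp: d_def)
    have "W s > 0" if "c < s" "s < d" for s
    proof -
      have "0 < m * (s - c)" using that \<open>m > 0\<close> by simp
      also have "\<dots> \<le> W s - W c" using that d c by (intro incr) auto
      finally show ?thesis using Wc by simp
    qed
    then have "\<exists>y. DERIV q s :> y \<and> y > 0" if "c < s" "s < d" for s
      using dq_open[of s] pos[of s] that d c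
      by (intro exI[of _ "W s / (\<phi> s)\<^sup>2"] conjI divide_pos_pos) auto
    moreover have "continuous_on {c..d} q"
      using d c by (intro continuous_on_subset[OF contq]) auto
    ultimately have "q c < q d"
      by (rule DERIV_pos_imp_increasing_open[OF \<open>c < d\<close>])
    then show False using max[of d] d c by simp
  next
    case False
    define d where "d = max 0 (c - r / 2)"
    have d: "d < c" "0 \<le> d" "c - d < r" "c = T" using False c T \<open>r > 0\<close> by (auto simp: d_def)
    have "W s < 0" if "d < s" "s < c" for s
    proof -
      have "0 < m * (c - s)" using that \<open>m > 0\<close> by simp
      also have "\<dots> \<le> W c - W s" using that d c by (intro incr) auto
      finally show ?thesis using Wc by simp
    qed
    then have "\<exists>y. DERIV q s :> y \<and> y < 0" if "d < s" "s < c" for s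
      using dq_open[of s] pos[of s] that d c
      by (intro exI[of _ "W s / (\<phi> s)\<^sup>2"] conjI divide_neg_pos) auto
    moreover have "continuous_on {d..c} q"
      using d c by (intro continuous_on_subset[OF contq]) auto
    ultimately have "q c < q d"
      by (rule DERIV_neg_imp_decreasing_open[OF \<open>d < c\<close>])
    then show False using max[of d] d c by simp
  qed
qed

section \<open>Comparison of the Neumann and mixed solutions\<close>

lemma even_ext_reflect: "even_ext T a (2 * T - t) = even_ext T a t"
  by (cases t T rule: linorder_cases) (auto simp: even_ext_def)

text \<open>The function \<open>\<phi> = - \<integral> G(\<cdot>, s) ds\<close> has the required properties; \<open>\<phi>' T = 0\<close> comes from the
  uniqueness built into the Green's function, by which \<open>\<phi>\<close> coincides with its reflection about
  \<open>T\<close>.\<close>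

lemma negative_green_imp_positive_torsion:
  assumes T: "T > 0"
    and green: "neumann_green (2 * T) (even_ext T a) G"
    and neg: "\<forall>t\<in>{0..2 * T}. \<forall>s\<in>{0..2 * T}. G t s < 0"
  obtains \<phi> \<psi> where "hill_solution T a (\<lambda>_. -1) \<phi> \<psi>" "\<forall>t\<in>{0..T}. \<phi> t > 0"
    "\<psi> 0 = 0" "\<psi> T = 0"
proof -
  let ?L = "2 * T" and ?b = "even_ext T a"
  define \<phi> where "\<phi> t = (LINT s:{0..2 * T}|lebesgue. G t s * (-1))" for t
  have one: "(\<lambda>_. -1 :: real) absolutely_integrable_on {0..?L}"
    by (rule absolutely_integrable_continuous_real) auto
  have sol: "neumann_solution ?L ?b (\<lambda>_. -1) w \<longleftrightarrow> (\<forall>t\<in>{0..?L}. w t = \<phi> t)" for w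
    using green one unfolding neumann_green_def \<phi>_def by blast
  then have "neumann_solution ?L ?b (\<lambda>_. -1) \<phi>" by simp
  then obtain \<psi> where \<psi>: "hill_solution ?L ?b (\<lambda>_. -1) \<phi> \<psi>" "\<psi> 0 = 0" "\<psi> ?L = 0"
    unfolding neumann_solution_def by blast
  have "hill_solution ?L ?b (\<lambda>_. -1) (\<lambda>t. \<phi> (?L - t)) (\<lambda>t. - \<psi> (?L - t))"
    using hill_solution_reflect[OF \<psi>(1)] by (simp only: even_ext_reflect)
  then have reflected: "neumann_solution ?L ?b (\<lambda>_. -1) (\<lambda>t. \<phi> (?L - t))"
    using \<psi> unfolding neumann_solution_def by (intro exI[of _ "\<lambda>t. - \<psi> (?L - t)"]) simp
  then have sym: "\<phi> (?L - t) = \<phi> t" if "t \<in> {0..?L}" for t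
    using that reflected sol[of "\<lambda>t. \<phi> (?L - t)"] by simp
  have dT: "(\<phi> has_real_derivative \<psi> T) (at T within {0..?L})"
    using \<psi>(1) T by (auto simp: hill_solution_def)
  then have "((\<lambda>t. \<phi> (?L - t)) has_real_derivative - \<psi> T) (at T within {0..?L})"
    by (intro has_real_derivative_reflect) simp
  then have "(\<phi> has_real_derivative - \<psi> T) (at T within {0..?L})"
    using sym T by (elim has_field_derivative_transform_within[where d = 1]) auto
  moreover have interior_T: "at T within {0..?L} = at T"
    using T by (intro at_within_interior) simp
  ultimately have "\<psi> T = - \<psi> T"
    using dT interior_T by (metis DERIV_unique)
  moreover have "\<phi> t > 0" if t: "t \<in> {0..?L}" for t
  proof -
    have "continuous_on ({0..?L} \<times> {0..?L}) (\<lambda>(t, s). G t s)"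
      using green by (simp add: neumann_green_def)
    then have "continuous_on {0..?L} (\<lambda>s. (\<lambda>(t, s). G t s) (t, s))"
      by (rule continuous_on_compose2) (use t in \<open>auto intro!: continuous_intros\<close>)
    then have cont: "continuous_on {0..?L} (\<lambda>s. G t s * (-1))"
      by (intro continuous_intros) simp
    have "integral {0..?L} (\<lambda>_. 0) < integral {0..?L} (\<lambda>s. G t s * (-1))"
      using t neg T cont by (intro integral_less_real) auto
    also have "\<dots> = \<phi> t"
      unfolding \<phi>_def
      by (rule set_lebesgue_integral_eq_integral(2)[symmetric],
          rule absolutely_integrable_continuous_real[OF cont])
    finally show ?thesis by simp
  qed
  moreover have "hill_solution T a (\<lambda>_. -1) \<phi> \<psi>"
    by (rule hill_solution_restrict[OF \<psi>(1)]) (use T in \<open>auto simp: even_ext_def\<close>)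
  ultimately show ?thesis using that[of \<phi> \<psi>] \<psi>(2) T by auto
qed

text \<open>The difference \<open>uN - uM\<close> need not satisfy either boundary condition at \<open>T\<close>. The maximum principle
  still applies to it, because \<open>uN T - uM T = uN T \<le> 0\<close> by the same principle for \<open>uN\<close>.\<close>

lemma neumann_mixed_comparison:
  assumes T: "T > 0"
    and \<phi>: "hill_solution T a (\<lambda>_. -1) \<phi> \<psi>" "\<forall>t\<in>{0..T}. \<phi> t > 0"
      "\<psi> 0 = 0" "\<psi> T = 0"
    and N: "hill_solution T a \<sigma>1 uN vN" "vN 0 = 0" "vN T = 0"
    and M: "hill_solution T a \<sigma>2 uM vM" "vM 0 = 0" "uM T = 0"
    and \<sigma>: "AE t in lebesgue_on {0..T}. 0 \<le> \<sigma>2 t \<and> \<sigma>2 t \<le> \<sigma>1 t"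
    and t: "t \<in> {0..T}"
  shows "uN t \<le> uM t \<and> uM t \<le> 0"
proof
  note max = maximum_principle[OF T \<phi>]
  show "uM t \<le> 0"
    by (rule max[OF M(1) _ M(2) _ t]) (use \<sigma> M in \<open>auto elim: eventually_mono\<close>)
  have "AE t in lebesgue_on {0..T}. 0 \<le> \<sigma>1 t"
    using \<sigma> by (rule eventually_mono) auto
  then have "uN T \<le> 0"
    by (rule max[OF N(1) _ N(2)]) (use N T in auto)
  then have "uN t - uM t \<le> 0"
    by (intro max[OF hill_solution_diff[OF N(1) M(1)] _ _ _ t])
       (use \<sigma> N M in \<open>auto elim!: eventually_mono\<close>)
  then show "uN t \<le> uM t" by simp
qed

theorem theorem4p15:
  fixes T :: real
    and a \<sigma>1 \<sigma>2 uN uM1 :: "real \<Rightarrow> real"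
    and G :: "real \<Rightarrow> real \<Rightarrow> real"
  assumes "T > 0"
    and "a absolutely_integrable_on {0..T}"
    and "neumann_nonresonant (2 * T) (even_ext T a)"
    and "neumann_green (2 * T) (even_ext T a) G"
    and "\<forall>t\<in>{0..2 * T}. \<forall>s\<in>{0..2 * T}. G t s < 0"
    and "\<sigma>1 absolutely_integrable_on {0..T}"
    and "\<sigma>2 absolutely_integrable_on {0..T}"
    and "neumann_solution T a \<sigma>1 uN"
    and "mixed1_solution T a \<sigma>2 uM1"
  shows "((AE t in lebesgue_on {0..T}. 0 \<le> \<sigma>2 t \<and> \<sigma>2 t \<le> \<sigma>1 t) \<longrightarrow>
            (\<forall>t\<in>{0..T}. uN t \<le> uM1 t \<and> uM1 t \<le> 0)) \<and>
         ((AE t in lebesgue_on {0..T}. 0 \<ge> \<sigma>2 t \<and> \<sigma>2 t \<ge> \<sigma>1 t) \<longrightarrow>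
            (\<forall>t\<in>{0..T}. uN t \<ge> uM1 t \<and> uM1 t \<ge> 0))"
proof -
  obtain \<phi> \<psi> where \<phi>: "hill_solution T a (\<lambda>_. -1) \<phi> \<psi>" "\<forall>t\<in>{0..T}. \<phi> t > 0"
    "\<psi> 0 = 0" "\<psi> T = 0"
    using negative_green_imp_positive_torsion assms by metis
  obtain vN where N: "hill_solution T a \<sigma>1 uN vN" "vN 0 = 0" "vN T = 0"
    using \<open>neumann_solution T a \<sigma>1 uN\<close> by (auto simp: neumann_solution_def)
  obtain vM where M: "hill_solution T a \<sigma>2 uM1 vM" "vM 0 = 0" "uM1 T = 0"
    using \<open>mixed1_solution T a \<sigma>2 uM1\<close> by (auto simp: mixed1_solution_def)
  note comparison = neumann_mixed_comparison[OF \<open>T > 0\<close> \<phi>]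
  show ?thesis
  proof (intro conjI impI)
    assume "AE t in lebesgue_on {0..T}. 0 \<le> \<sigma>2 t \<and> \<sigma>2 t \<le> \<sigma>1 t"
    then show "\<forall>t\<in>{0..T}. uN t \<le> uM1 t \<and> uM1 t \<le> 0"
      using comparison[OF N M] by blast
  next
    assume "AE t in lebesgue_on {0..T}. 0 \<ge> \<sigma>2 t \<and> \<sigma>2 t \<ge> \<sigma>1 t"
    then have "AE t in lebesgue_on {0..T}. 0 \<le> - \<sigma>2 t \<and> - \<sigma>2 t \<le> - \<sigma>1 t"
      by simp
    then have "- uN t \<le> - uM1 t \<and> - uM1 t \<le> 0" if "t \<in> {0..T}" for t
      using N M that
      by (intro comparison[OF hill_solution_minus[OF N(1)] _ _ hill_solution_minus[OF M(1)]])
         simp_all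
    then show "\<forall>t\<in>{0..T}. uN t \<ge> uM1 t \<and> uM1 t \<ge> 0"
      by simp
  qed
qed

end
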